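(* Let $n\ge1$. Then: (i) $\mathrm{Reg}(\mathcal{ORCT}_n)$ is a regular subsemigroup of $\mathcal{ORCT}_n$; (ii) $\langle E(\mathcal{ORCT}_n)\rangle=E(\mathcal{ORCT}_n)$; (iii) $\mathrm{Reg}(\mathcal{ORCT}_n)$ is orthodox.
   Context: $[n]=\{1,\ldots,n\}$. $\mathcal{ORCT}_n$ is the semigroup, under composition, of all maps $\alpha:[n]\to[n]$ that satisfy $|x\alpha-y\alpha|\le|x-y|$ for all $x,y\in[n]$ and are either order preserving or order reversing. An element $a$ of a semigroup $S$ is regular if $a=aba$ for some $b\in S$; a semigroup is regular if all its elements are regular (in it). $\mathrm{Reg}(S)$ is the set of regular elements of $S$, $E(S)$ the set of idempotents, and $\langle A\rangle$ the subsemigroup generated by $A$. A semigroup $S$ is orthodox if $E(S)$ is a subsemigroup of $S$. *)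

theory Defs
  imports Main "HOL-Library.FuncSet"
begin

text \<open>
  Semigroups are given by a carrier set and a binary operation that need only be well behaved
  on the carrier; they are nonempty by convention. (The class-based \<open>semigroup\<close> of the library
  has a whole type as its carrier, so it cannot express subsemigroups.)
\<close>

definition semigroup_on :: "('a \<Rightarrow> 'a \<Rightarrow> 'a) \<Rightarrow> 'a set \<Rightarrow> bool" where
  "semigroup_on mult S \<longleftrightarrow>
     S \<noteq> {} \<and>
     (\<forall>a\<in>S. \<forall>b\<in>S. mult a b \<in> S) \<and>
     (\<forall>a\<in>S. \<forall>b\<in>S. \<forall>c\<in>S. mult (mult a b) c = mult a (mult b c))"

definition subsemigroup :: "('a \<Rightarrow> 'a \<Rightarrow> 'a) \<Rightarrow> 'a set \<Rightarrow> 'a set \<Rightarrow> bool" where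
  "subsemigroup mult T S \<longleftrightarrow> T \<subseteq> S \<and> semigroup_on mult T"

definition regular_element :: "('a \<Rightarrow> 'a \<Rightarrow> 'a) \<Rightarrow> 'a set \<Rightarrow> 'a \<Rightarrow> bool" where
  "regular_element mult S a \<longleftrightarrow> a \<in> S \<and> (\<exists>b\<in>S. a = mult (mult a b) a)"

definition Reg :: "('a \<Rightarrow> 'a \<Rightarrow> 'a) \<Rightarrow> 'a set \<Rightarrow> 'a set" where
  "Reg mult S = {a. regular_element mult S a}"

definition regular_semigroup :: "('a \<Rightarrow> 'a \<Rightarrow> 'a) \<Rightarrow> 'a set \<Rightarrow> bool" where
  "regular_semigroup mult S \<longleftrightarrow>
     semigroup_on mult S \<and> (\<forall>a\<in>S. regular_element mult S a)"

definition Idem :: "('a \<Rightarrow> 'a \<Rightarrow> 'a) \<Rightarrow> 'a set \<Rightarrow> 'a set" where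
  "Idem mult S = {e \<in> S. mult e e = e}"

inductive_set generated :: "('a \<Rightarrow> 'a \<Rightarrow> 'a) \<Rightarrow> 'a set \<Rightarrow> 'a set"
  for mult :: "'a \<Rightarrow> 'a \<Rightarrow> 'a" and A :: "'a set" where
  incl: "a \<in> A \<Longrightarrow> a \<in> generated mult A"
| mult: "a \<in> generated mult A \<Longrightarrow> b \<in> generated mult A \<Longrightarrow> mult a b \<in> generated mult A"

definition orthodox :: "('a \<Rightarrow> 'a \<Rightarrow> 'a) \<Rightarrow> 'a set \<Rightarrow> bool" where
  "orthodox mult S \<longleftrightarrow> semigroup_on mult S \<and> subsemigroup mult (Idem mult S) S"

text \<open>
  Maps from \<open>{1..n}\<close> to itself are represented as extensional functions, so that equality of
  HOL functions is equality of maps. Maps act on the right: the product of \<open>\<alpha>\<close> and \<open>\<beta>\<close> applies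
  \<open>\<alpha>\<close> first.
\<close>

definition ORCT :: "nat \<Rightarrow> (nat \<Rightarrow> nat) set" where
  "ORCT n = {\<alpha> \<in> {1..n} \<rightarrow>\<^sub>E {1..n}.
     (\<forall>x\<in>{1..n}. \<forall>y\<in>{1..n}. \<bar>int (\<alpha> x) - int (\<alpha> y)\<bar> \<le> \<bar>int x - int y\<bar>) \<and>
     (mono_on {1..n} \<alpha> \<or> antimono_on {1..n} \<alpha>)}"

definition map_mult :: "nat \<Rightarrow> (nat \<Rightarrow> nat) \<Rightarrow> (nat \<Rightarrow> nat) \<Rightarrow> (nat \<Rightarrow> nat)" where
  "map_mult n \<alpha> \<beta> = compose {1..n} \<beta> \<alpha>"

lemma semigroup_on_ORCT: "semigroup_on (map_mult n) (ORCT n)"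
proof -
  have "(\<lambda>x\<in>{1..n}. x) \<in> ORCT n"
    by (auto simp: ORCT_def monotone_on_def)
  moreover have "map_mult n a b \<in> ORCT n" if a: "a \<in> ORCT n" and b: "b \<in> ORCT n" for a b
  proof -
    have aP: "a x \<in> {1..n}" and bP: "b x \<in> {1..n}" if "x \<in> {1..n}" for x
      using a b that unfolding ORCT_def by (blast dest: PiE_mem)+
    have "map_mult n a b \<in> {1..n} \<rightarrow>\<^sub>E {1..n}"
      using aP bP by (fastforce simp: map_mult_def compose_def)
    moreover have "\<bar>int (map_mult n a b x) - int (map_mult n a b y)\<bar> \<le> \<bar>int x - int y\<bar>"
      if "x \<in> {1..n}" "y \<in> {1..n}" for x y
    proof -
      have "\<bar>int (b (a x)) - int (b (a y))\<bar> \<le> \<bar>int (a x) - int (a y)\<bar>"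
        using b aP that unfolding ORCT_def by blast
      also have "\<dots> \<le> \<bar>int x - int y\<bar>"
        using a that unfolding ORCT_def by blast
      finally show ?thesis
        using that by (simp add: map_mult_def compose_def)
    qed
    moreover have "mono_on {1..n} (map_mult n a b) \<or> antimono_on {1..n} (map_mult n a b)"
    proof -
      have ma: "mono_on {1..n} a \<or> antimono_on {1..n} a"
        and mb: "mono_on {1..n} b \<or> antimono_on {1..n} b"
        using a b unfolding ORCT_def by blast+
      have eq: "map_mult n a b x = b (a x)" if "x \<in> {1..n}" for x
        using that by (simp add: map_mult_def compose_def)
      show ?thesis
        using ma mb unfolding monotone_on_def by (metis aP eq)
    qed
    ultimately show ?thesis
      unfolding ORCT_def by blast
  qed
  moreover have "map_mult n (map_mult n a b) c = map_mult n a (map_mult n b c)"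
    if "a \<in> ORCT n" for a b c
  proof -
    have "a \<in> {1..n} \<rightarrow> {1..n}"
      using that unfolding ORCT_def by blast
    then show ?thesis
      unfolding map_mult_def by (rule compose_assoc)
  qed
  ultimately show ?thesis
    unfolding semigroup_on_def by blast
qed

end

(* An idempotent of ORCT n is a clamping map x |-> max c (min d x), and a product of two clamping
   maps is again one; hence the idempotents form a band. In any semigroup whose idempotents are
   closed under products, so are the regular elements: if a = a a' a and b = b b' b, then e = a' a
   and f = b b' are idempotent with a = a e and b = f b, whence
   (a b)(b' a')(a b) = a f e b = a (e f)(e f) b = a e f b = a b. *)

theory Submission
  imports Defs
begin

text \<open>Generation adds nothing to a set that is already closed, by induction on how an element
  is generated. Claim (ii) thus reduces to closure of the idempotents under products.\<close>

lemma generated_eq_self: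
  assumes "\<And>a b. a \<in> A \<Longrightarrow> b \<in> A \<Longrightarrow> mult a b \<in> A"
  shows "generated mult A = A"
proof
  show "generated mult A \<subseteq> A"
  proof
    fix x assume "x \<in> generated mult A"
    then show "x \<in> A" by induction (auto intro: assms)
  qed
qed (auto intro: generated.incl)

context
  fixes mult :: "'a \<Rightarrow> 'a \<Rightarrow> 'a" (infixl \<open>\<cdot>\<close> 70) and S :: "'a set"
  assumes S: "semigroup_on mult S"
begin

lemma closed: "a \<in> S \<Longrightarrow> b \<in> S \<Longrightarrow> a \<cdot> b \<in> S"
  and assoc: "a \<in> S \<Longrightarrow> b \<in> S \<Longrightarrow> c \<in> S \<Longrightarrow> a \<cdot> b \<cdot> c = a \<cdot> (b \<cdot> c)"
  using S unfolding semigroup_on_def by blast+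

lemma Reg_subset: "Reg mult S \<subseteq> S"
  unfolding Reg_def regular_element_def by blast

lemma Idem_subset_Reg: "Idem mult S \<subseteq> Reg mult S"
  unfolding Idem_def Reg_def regular_element_def by force

lemma Idem_Reg: "Idem mult (Reg mult S) = Idem mult S"
  using Reg_subset Idem_subset_Reg unfolding Idem_def by blast

text \<open>A witness \<open>c\<close> for the regularity of \<open>a\<close> in \<open>S\<close>
  need not be regular itself, but \<open>c \<cdot> a \<cdot> c\<close> is also a witness, and it is
  regular by way of \<open>a\<close>. Hence \<open>Reg mult S\<close> is regular in itself, not
  merely in \<open>S\<close>.\<close>

lemma Reg_inverse:
  assumes "a \<in> Reg mult S"
  obtains b where "b \<in> Reg mult S" "a \<cdot> b \<cdot> a = a"
proof -
  obtain c where c: "c \<in> S" "a \<cdot> c \<cdot> a = a" and a: "a \<in> S"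
    using assms unfolding Reg_def regular_element_def by auto
  \<comment> \<open>Right-nested forms of \<open>a \<cdot> c \<cdot> a = a\<close>, with and without
    a further factor, match the terms left after rewriting with \<open>assoc\<close>.\<close>
  have aca: "a \<cdot> (c \<cdot> a) = a" and acax: "a \<cdot> (c \<cdot> (a \<cdot> x)) = a \<cdot> x" if "x \<in> S" for x
    using a c that by (metis assoc closed)+
  let ?b = "c \<cdot> a \<cdot> c"
  have "?b \<cdot> a \<cdot> ?b = ?b" "a \<cdot> ?b \<cdot> a = a"
    using a c by (simp_all add: assoc closed aca acax)
  moreover have "?b \<in> S"
    using a c by (simp add: closed)
  ultimately show thesis
    using that[of ?b] a unfolding Reg_def regular_element_def by force
qed

lemma Reg_mult:
  assumes Idem: "\<And>e f. e \<in> Idem mult S \<Longrightarrow> f \<in> Idem mult S \<Longrightarrow> e \<cdot> f \<in> Idem mult S"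
    and "a \<in> Reg mult S" "b \<in> Reg mult S"
  shows "a \<cdot> b \<in> Reg mult S"
proof -
  obtain a' where a': "a' \<in> S" "a \<cdot> a' \<cdot> a = a" and a: "a \<in> S"
    using assms(2) unfolding Reg_def regular_element_def by auto
  obtain b' where b': "b' \<in> S" "b \<cdot> b' \<cdot> b = b" and b: "b \<in> S"
    using assms(3) unfolding Reg_def regular_element_def by auto
  define e f where "e = a' \<cdot> a" and "f = b \<cdot> b'"
  have ef: "e \<in> S" "f \<in> S"
    using a a' b b' by (simp_all add: e_def f_def closed)
  have ae: "a \<cdot> e = a" and fb: "f \<cdot> b = b"
    using a a' b b' by (simp_all add: e_def f_def assoc)
  have "e \<cdot> e = e" "f \<cdot> f = f"
    using a a' b b' ae fb ef unfolding e_def f_def by (metis assoc closed)+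
  then have "e \<cdot> f \<in> Idem mult S"
    using ef by (intro Idem) (auto simp: Idem_def)
  then have idem: "e \<cdot> f \<cdot> (e \<cdot> f) = e \<cdot> f"
    by (simp add: Idem_def)
  have "a \<cdot> b \<cdot> (b' \<cdot> a') \<cdot> (a \<cdot> b) = a \<cdot> (f \<cdot> (e \<cdot> b))"
    using a a' b b' by (simp add: e_def f_def assoc closed)
  also have "\<dots> = (a \<cdot> e) \<cdot> (f \<cdot> (e \<cdot> (f \<cdot> b)))"
    by (simp add: ae fb)
  also have "\<dots> = a \<cdot> (e \<cdot> f \<cdot> (e \<cdot> f)) \<cdot> b"
    using a b ef by (simp add: assoc closed)
  also have "\<dots> = (a \<cdot> e) \<cdot> (f \<cdot> b)"
    unfolding idem using a b ef by (simp add: assoc closed)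
  also have "\<dots> = a \<cdot> b"
    by (simp add: ae fb)
  finally show ?thesis
    using a a' b b' closed unfolding Reg_def regular_element_def by force
qed

lemma regular_orthodox_Reg:
  assumes Idem: "\<And>e f. e \<in> Idem mult S \<Longrightarrow> f \<in> Idem mult S \<Longrightarrow> e \<cdot> f \<in> Idem mult S"
    and ne: "Idem mult S \<noteq> {}"
  shows "subsemigroup mult (Reg mult S) S"
    and "regular_semigroup mult (Reg mult S)"
    and "orthodox mult (Reg mult S)"
proof -
  have sub: "Idem mult S \<subseteq> S"
    unfolding Idem_def by blast
  have R: "semigroup_on mult (Reg mult S)"
    unfolding semigroup_on_def
    using ne Idem_subset_Reg Reg_mult[OF Idem] Reg_subset assoc by (auto simp: subset_iff)
  have E: "semigroup_on mult (Idem mult S)"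
    unfolding semigroup_on_def using ne Idem sub assoc by (auto simp: subset_iff)
  show "subsemigroup mult (Reg mult S) S"
    using R Reg_subset by (simp add: subsemigroup_def)
  show "regular_semigroup mult (Reg mult S)"
    using R unfolding regular_semigroup_def regular_element_def by (metis Reg_inverse)
  show "orthodox mult (Reg mult S)"
    using R E Idem_subset_Reg by (simp add: orthodox_def subsemigroup_def Idem_Reg)
qed

end

text \<open>The bounds are \<open>e 1\<close> and \<open>e n\<close>, both fixed points of
  \<open>e\<close>. Monotonicity makes \<open>e\<close> constant on either side of them, and
  contraction makes it the identity between them.\<close>

lemma Idem_ORCT_clamp:
  assumes "n \<ge> 1" and "e \<in> Idem (map_mult n) (ORCT n)"
  obtains c d where "c \<le> d" "\<And>x. x \<in> {1..n} \<Longrightarrow> e x = max c (min d x)"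
proof -
  have e: "e \<in> ORCT n" and ee: "map_mult n e e = e"
    using assms(2) by (auto simp: Idem_def)
  have range: "e x \<in> {1..n}" if "x \<in> {1..n}" for x
    using e that unfolding ORCT_def by blast
  have contr: "\<bar>int (e x) - int (e y)\<bar> \<le> \<bar>int x - int y\<bar>" if "x \<in> {1..n}" "y \<in> {1..n}" for x y
    using e that unfolding ORCT_def by blast
  have idem: "e (e x) = e x" if "x \<in> {1..n}" for x
    using fun_cong[OF ee, of x] that by (simp add: map_mult_def compose_def)
  have mono: "e x \<le> e y" if "x \<in> {1..n}" "y \<in> {1..n}" "x \<le> y" for x y
  proof -
    consider "mono_on {1..n} e" | "antimono_on {1..n} e"
      using e unfolding ORCT_def by blast
    then show ?thesis
    proof cases
      case 1
      then show ?thesis using that by (blast dest: monotone_onD)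
    next
      \<comment> \<open>An antitone idempotent is constant, since \<open>e = e \<circ> e\<close> is also monotone.\<close>
      case 2
      then have "e y \<le> e x"
        using that by (blast dest: monotone_onD)
      then have "e (e x) \<le> e (e y)"
        using 2 range that by (blast dest: monotone_onD)
      then show ?thesis
        using idem that by simp
    qed
  qed
  have 1: "1 \<in> {1..n}" and n: "n \<in> {1..n}"
    using assms(1) by auto
  show thesis
  proof
    show "e 1 \<le> e n"
      using mono 1 n by simp
  next
    fix x assume x: "x \<in> {1..n}"
    have bounds: "e 1 \<le> e x" "e x \<le> e n"
      using mono x 1 n by auto
    consider "x < e 1" | "e n < x" | "e 1 \<le> x" "x \<le> e n"
      by linarith
    then show "e x = max (e 1) (min (e n) x)"
    proof cases
      case 1
      then have "e x \<le> e 1"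
        using mono[of x "e 1"] idem \<open>1 \<in> {1..n}\<close> range x by simp
      then show ?thesis
        using 1 bounds by simp
    next
      case 2
      then have "e n \<le> e x"
        using mono[of "e n" x] idem n range x by simp
      then show ?thesis
        using 2 bounds by simp
    next
      \<comment> \<open>Contraction towards the fixed point \<open>e 1\<close> gives
        \<open>e x \<le> x\<close>, and towards the fixed point \<open>e n\<close> it gives
        \<open>x \<le> e x\<close>.\<close>
      case 3
      then show ?thesis
        using contr[OF x range[OF 1]] contr[OF x range[OF n]] idem[OF 1] idem[OF n] bounds
        by linarith
    qed
  qed
qed

text \<open>The bounds of the composite clamp are not computed; it is enough that
  \<open>f (e v) = v\<close> for every value \<open>v = f (e x)\<close>.\<close>

lemma Idem_ORCT_mult:
  assumes "n \<ge> 1" and e: "e \<in> Idem (map_mult n) (ORCT n)" and f: "f \<in> Idem (map_mult n) (ORCT n)"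
  shows "map_mult n e f \<in> Idem (map_mult n) (ORCT n)"
proof -
  obtain c d where cd: "c \<le> d" "\<And>x. x \<in> {1..n} \<Longrightarrow> e x = max c (min d x)"
    using Idem_ORCT_clamp[OF assms(1) e] by blast
  obtain c' d' where cd': "c' \<le> d'" "\<And>x. x \<in> {1..n} \<Longrightarrow> f x = max c' (min d' x)"
    using Idem_ORCT_clamp[OF assms(1) f] by blast
  let ?g = "map_mult n e f"
  have eS: "e \<in> ORCT n" and fS: "f \<in> ORCT n"
    using e f by (auto simp: Idem_def)
  have range: "e x \<in> {1..n}" "f x \<in> {1..n}" if "x \<in> {1..n}" for x
    using eS fS that unfolding ORCT_def by blast+
  have "map_mult n ?g ?g x = ?g x" for x
  proof (cases "x \<in> {1..n}")
    case True
    define u v where "u = e x" and "v = f u"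
    have "u \<in> {1..n}" "v \<in> {1..n}" "e v \<in> {1..n}"
      using True range by (simp_all only: u_def v_def)
    then have u: "c \<le> u" "u \<le> d" and v: "v = max c' (min d' u)"
      and ev: "e v = max c (min d v)" and fev: "f (e v) = max c' (min d' (e v))"
      using cd True cd' by (simp_all only: u_def v_def)
    \<comment> \<open>If \<open>v\<close> lies in the interval from \<open>c\<close> to
      \<open>d\<close>, both maps fix it. If \<open>v < c\<close>, then \<open>f\<close> has lowered
      \<open>u\<close>, so \<open>v = d'\<close>; now \<open>e v = c\<close> exceeds
      \<open>d'\<close> and \<open>f\<close> sends it back to \<open>d'\<close>. The case
      \<open>d < v\<close> is dual, with \<open>v = c'\<close>.\<close>
    consider "v < c" | "d < v" | "c \<le> v" "v \<le> d"
      by linarith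
    then have "f (e v) = v"
      by cases (use u v ev fev cd'(1) in linarith)+
    then have "f (e (f (e x))) = f (e x)"
      by (simp only: u_def v_def)
    then show ?thesis
      using True range by (simp add: map_mult_def compose_def)
  next
    \<comment> \<open>Off the domain both sides are \<open>undefined\<close>, so the maps agree as
      HOL functions.\<close>
    case False
    then show ?thesis
      by (simp only: map_mult_def compose_def restrict_def if_False)
  qed
  moreover have "?g \<in> ORCT n"
    using semigroup_on_ORCT eS fS unfolding semigroup_on_def by blast
  ultimately show ?thesis
    unfolding Idem_def by blast
qed

text \<open>The identity map is the witness. Semigroups are nonempty by convention, so this is
  needed for both the idempotents and the regular elements.\<close>

lemma Idem_ORCT_nonempty: "Idem (map_mult n) (ORCT n) \<noteq> {}"
proof -
  have "(\<lambda>x\<in>{1..n}. x) \<in> Idem (map_mult n) (ORCT n)"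
    by (auto simp: Idem_def ORCT_def monotone_on_def map_mult_def compose_def restrict_def)
  then show ?thesis by blast
qed

theorem theorem3p3:
  fixes n :: nat
  assumes "n \<ge> 1"
  shows "(subsemigroup (map_mult n) (Reg (map_mult n) (ORCT n)) (ORCT n)
          \<and> regular_semigroup (map_mult n) (Reg (map_mult n) (ORCT n)))
       \<and> generated (map_mult n) (Idem (map_mult n) (ORCT n)) = Idem (map_mult n) (ORCT n)
       \<and> orthodox (map_mult n) (Reg (map_mult n) (ORCT n))"
proof -
  note Idem = Idem_ORCT_mult[OF assms]
  note regular_orthodox_Reg[OF semigroup_on_ORCT _ Idem_ORCT_nonempty]
  from this[OF Idem] generated_eq_self[of _ "map_mult n", OF Idem] show ?thesis
    by simp
qed

end
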